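(* The confining cop number of every connected cograph on fewer than $8$ vertices is equal to $1$. Moreover, for every $n\ge 8$ there is a connected cograph $G$ on $n$ vertices such that $ccn(G)=2$.
   Context: A cograph is a graph with no induced path on $4$ vertices. Game of Cops and Robbers: cops choose vertices first, then the robber; players alternate, each moving to an adjacent vertex or staying; capture when a cop occupies the robber's vertex. The robber is confined if it has to stay at its current vertex in order to avoid capture in the next move of the cops. $ccn(G)$, the confining cop number, is the minimum number of cops that can force confinement (or capture) of the robber. *)

theory Defs
  imports "Graph_Theory.Graph_Theory"
begin

text \<open>
  A finite simple undirected graph is a \<open>pair_graph\<close>: a finite, loop-free digraph whose arc
  set is a symmetric set of pairs, so that an edge between \<open>u\<close> and \<open>v\<close> is the statement
  \<open>u \<rightarrow>\<^bsub>G\<^esub> v\<close>.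
\<close>

definition induced_P4 :: "'a pair_pre_digraph \<Rightarrow> 'a \<Rightarrow> 'a \<Rightarrow> 'a \<Rightarrow> 'a \<Rightarrow> bool" where
  "induced_P4 G a b c d \<longleftrightarrow>
     distinct [a, b, c, d] \<and> {a, b, c, d} \<subseteq> pverts G \<and>
     a \<rightarrow>\<^bsub>G\<^esub> b \<and> b \<rightarrow>\<^bsub>G\<^esub> c \<and> c \<rightarrow>\<^bsub>G\<^esub> d \<and>
     \<not> a \<rightarrow>\<^bsub>G\<^esub> c \<and> \<not> a \<rightarrow>\<^bsub>G\<^esub> d \<and> \<not> b \<rightarrow>\<^bsub>G\<^esub> d"

definition cograph :: "'a pair_pre_digraph \<Rightarrow> bool" where
  "cograph G \<longleftrightarrow> pair_graph G \<and> (\<nexists>a b c d. induced_P4 G a b c d)"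

text \<open>
  The qualified name is needed because the unqualified one may denote topological connectedness.
  The library notion requires the vertex set to be nonempty.
\<close>

definition connected_cograph :: "'a pair_pre_digraph \<Rightarrow> bool" where
  "connected_cograph G \<longleftrightarrow> cograph G \<and> Digraph_Component.connected (with_proj G)"

definition legal_move :: "'a pair_pre_digraph \<Rightarrow> 'a \<Rightarrow> 'a \<Rightarrow> bool" where
  "legal_move G u v \<longleftrightarrow> v = u \<or> u \<rightarrow>\<^bsub>G\<^esub> v"

text \<open>
  The positions of \<open>k\<close> cops form a list of length \<open>k\<close>, so several cops may share a vertex. In
  one turn, every cop makes a move of its own (or stays).
\<close>

definition cops_move :: "'a pair_pre_digraph \<Rightarrow> 'a list \<Rightarrow> 'a list \<Rightarrow> bool" where
  "cops_move G C C' \<longleftrightarrow> list_all2 (legal_move G) C C'"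

definition captured :: "'a list \<Rightarrow> 'a \<Rightarrow> bool" where
  "captured C r \<longleftrightarrow> r \<in> set C"

definition can_capture :: "'a pair_pre_digraph \<Rightarrow> 'a list \<Rightarrow> 'a \<Rightarrow> bool" where
  "can_capture G C r \<longleftrightarrow> (\<exists>C'. cops_move G C C' \<and> captured C' r)"

text \<open>
  With the robber to move: staying is safe from capture in the next move of the cops, and no
  other move is.
\<close>

definition confined :: "'a pair_pre_digraph \<Rightarrow> 'a list \<Rightarrow> 'a \<Rightarrow> bool" where
  "confined G C r \<longleftrightarrow>
     \<not> can_capture G C r \<and>
     (\<forall>r'. legal_move G r r' \<and> r' \<noteq> r \<longrightarrow> can_capture G C r')"

text \<open>
  \<open>cops_win G C r\<close>: with the cops at \<open>C\<close>, the robber at \<open>r\<close> and the cops to move, the cops can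
  force capture or confinement of the robber within finitely many rounds. The rule
  \<open>already_captured\<close> covers a robber that has placed or moved itself onto a cop.
\<close>

inductive cops_win :: "'a pair_pre_digraph \<Rightarrow> 'a list \<Rightarrow> 'a \<Rightarrow> bool" for G where
  already_captured: "captured C r \<Longrightarrow> cops_win G C r"
| capture: "cops_move G C C' \<Longrightarrow> captured C' r \<Longrightarrow> cops_win G C r"
| confine: "cops_move G C C' \<Longrightarrow> confined G C' r \<Longrightarrow> cops_win G C r"
| continue: "cops_move G C C' \<Longrightarrow> (\<And>r'. legal_move G r r' \<Longrightarrow> cops_win G C' r') \<Longrightarrow>
    cops_win G C r"

definition can_confine :: "'a pair_pre_digraph \<Rightarrow> nat \<Rightarrow> bool" where
  "can_confine G k \<longleftrightarrow>
     (\<exists>C. length C = k \<and> set C \<subseteq> pverts G \<and> (\<forall>r \<in> pverts G. cops_win G C r))"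

text \<open>
  The game is played with at least one cop. On a finite nonempty graph the minimum exists, since
  one cop on every vertex captures the robber at once.
\<close>

definition ccn :: "'a pair_pre_digraph \<Rightarrow> nat" where
  "ccn G = (LEAST k. k \<ge> 1 \<and> can_confine G k)"

end

theory Submission
  imports Defs
begin

text \<open>
  If the cop at \<open>c\<close> does not dominate a vertex \<open>r\<close> but dominates all its neighbours, a robber at
  \<open>r\<close> is confined; so one cop suffices as soon as some \<open>c\<close> has this property for every
  non-neighbour \<open>r\<close>. In a non-complete connected cograph, every vertex of a minimum separator is
  adjacent to everything outside the separator, so the graph is a join. With fewer than eight
  vertices one side of the join has at most three vertices, and such a side contains a suitable \<open>c\<close>.

  For \<open>n \<ge> 8\<close>, replace the vertices of a four-cycle by cliques with at least two vertices each.
  Against one cop the robber can always stay in or return to the clique opposite the cop, where it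
  is never confined. Two cops on adjacent cliques dominate the graph.
\<close>

section \<open>Separators in cographs\<close>

text \<open>\<open>A\<close> and \<open>B\<close> need not be components, so a side can be split and
  its pieces regrouped.\<close>

definition separation :: "'a pair_pre_digraph \<Rightarrow> 'a set \<Rightarrow> 'a set \<Rightarrow> 'a set \<Rightarrow> bool" where
  "separation G S A B \<longleftrightarrow>
     A \<noteq> {} \<and> B \<noteq> {} \<and> S \<inter> A = {} \<and> S \<inter> B = {} \<and> A \<inter> B = {} \<and> S \<union> A \<union> B = pverts G \<and>
     (\<forall>a \<in> A. \<forall>b \<in> B. (a, b) \<notin> parcs G)"

lemma (in pair_graph) parcs_sym: "(u, v) \<in> parcs G \<Longrightarrow> (v, u) \<in> parcs G"
  using arcs_ends_symmetric[OF pair_sym_arcs, of u v] by simp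

lemma (in pair_graph) parcs_irrefl: "(u, u) \<notin> parcs G"
  using pair_no_loops by fastforce

lemma (in pair_graph) separation_commute: "separation G S A B \<Longrightarrow> separation G S B A"
  unfolding separation_def by (auto dest: parcs_sym)

lemma (in pair_graph) connected_iff:
  "Digraph_Component.connected (with_proj G) \<longleftrightarrow>
     pverts G \<noteq> {} \<and> (\<forall>u \<in> pverts G. \<forall>v \<in> pverts G. reachable (with_proj G) u v)"
  using reachable_mk_symmetric_eq[OF pair_sym_arcs]
  by (simp add: connected_def strongly_connected_def)

text \<open>With \<open>S\<close> empty, \<open>A\<close> is closed under arcs, so no walk from
  \<open>A\<close> reaches \<open>B\<close>.\<close>

lemma (in pair_graph) connected_separation_nonempty:
  assumes "Digraph_Component.connected (with_proj G)" "separation G S A B"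
  shows "S \<noteq> {}"
proof
  assume "S = {}"
  with assms(2) obtain a b where a: "a \<in> A" and b: "b \<in> B" and ab: "A \<inter> B = {}"
    and V: "pverts G = A \<union> B" and no: "\<And>a b. a \<in> A \<Longrightarrow> b \<in> B \<Longrightarrow> (a, b) \<notin> parcs G"
    unfolding separation_def by auto
  have "reachable (with_proj G) a b"
    using assms(1) a b V unfolding connected_iff by blast
  then have "b \<in> A"
  proof (induction rule: reachable_induct)
    case base
    show ?case by (rule a)
  next
    case (step x y)
    then show ?case using no in_arcsD2 V by auto
  qed
  then show False using b ab by blast
qed

text \<open>Minimality gives \<open>s\<close> a neighbour on each side of every separation with this
  \<open>S\<close>. If \<open>s\<close> missed a vertex of a side, the absence of induced paths
  would split its non-neighbours there off as a side of their own, without a neighbour of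
  \<open>s\<close>.\<close>

lemma (in pair_graph) minimal_separator_joined:
  assumes P4: "\<nexists>a b c d. induced_P4 G a b c d"
    and sep: "separation G S A B"
    and min: "\<And>S' A' B'. separation G S' A' B' \<Longrightarrow> card S \<le> card S'"
    and s: "s \<in> S" and v: "v \<in> pverts G - S"
  shows "(s, v) \<in> parcs G"
proof -
  have nbr: "\<exists>a \<in> A'. (s, a) \<in> parcs G" if sep': "separation G S A' B'" for A' B'
  proof (rule ccontr)
    assume "\<not> ?thesis"
    \<comment> \<open>Moving \<open>s\<close> to the other side would leave a smaller
      separator.\<close>
    then have "separation G (S - {s}) A' (insert s B')"
      using sep' s parcs_sym unfolding separation_def by auto
    then have "card S \<le> card (S - {s})" by (rule min)
    moreover have "finite S"
      using sep pair_finite_verts finite_subset[of S] unfolding separation_def by blast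
    ultimately show False using s by (metis card_Diff1_less not_le)
  qed
  have *: "\<forall>v \<in> A'. (s, v) \<in> parcs G" if sep': "separation G S A' B'" for A' B'
  proof (rule ccontr)
    assume neg: "\<not> ?thesis"
    define N where "N = {x \<in> A'. (s, x) \<notin> parcs G}"
    obtain w where w: "w \<in> B'" "(s, w) \<in> parcs G"
      using nbr[OF separation_commute[OF sep']] by blast
    \<comment> \<open>An arc from \<open>N\<close> to the rest of \<open>A'\<close> would give the
      induced path \<open>w, s, y, x\<close>.\<close>
    have no: "(x, y) \<notin> parcs G" if "x \<in> N" "y \<in> A' - N" for x y
    proof
      assume "(x, y) \<in> parcs G"
      moreover have "(s, y) \<in> parcs G" "(s, x) \<notin> parcs G" using that by (auto simp: N_def)
      moreover have A': "x \<in> A'" "y \<in> A'" using that by (auto simp: N_def)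
      moreover have "(w, y) \<notin> parcs G" "(w, x) \<notin> parcs G"
        using separation_commute[OF sep'] A' w(1) unfolding separation_def by auto
      moreover have "x \<noteq> w" "y \<noteq> w" "s \<noteq> x" "s \<noteq> y" "s \<noteq> w"
        using sep' A' w(1) s unfolding separation_def by auto
      moreover have "{w, s, y, x} \<subseteq> pverts G"
        using sep' A' w(1) s unfolding separation_def by auto
      moreover have "x \<noteq> y" using that by auto
      ultimately have "induced_P4 G w s y x"
        using parcs_sym[OF w(2)] parcs_sym[of x y] unfolding induced_P4_def by auto
      then show False using P4 by blast
    qed
    have disj: "B' \<noteq> {}" "S \<inter> A' = {}" "S \<inter> B' = {}" "A' \<inter> B' = {}" "S \<union> A' \<union> B' = pverts G"
      "\<And>a b. a \<in> A' \<Longrightarrow> b \<in> B' \<Longrightarrow> (a, b) \<notin> parcs G"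
      using sep' by (simp_all add: separation_def)
    have "separation G S N (B' \<union> (A' - N))"
      unfolding separation_def
    proof (intro conjI ballI)
      show "N \<noteq> {}" using neg by (auto simp: N_def)
      show "(x, y) \<notin> parcs G" if "x \<in> N" "y \<in> B' \<union> (A' - N)" for x y
        using that no[of x y] disj(6) by (auto simp: N_def)
    qed (use disj in \<open>auto simp: N_def\<close>)
    from nbr[OF this] show False by (auto simp: N_def)
  qed
  have "v \<in> A \<or> v \<in> B" using v sep by (auto simp: separation_def)
  then show ?thesis using *[OF sep] *[OF separation_commute[OF sep]] by blast
qed

text \<open>A missing edge makes the remaining vertices a separator, so a minimum one exists;
  connectedness makes it nonempty, and it serves as one side of the join.\<close>

lemma (in pair_graph) cograph_join:
  assumes P4: "\<nexists>a b c d. induced_P4 G a b c d"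
    and con: "Digraph_Component.connected (with_proj G)"
    and uv: "u \<in> pverts G" "v \<in> pverts G" "u \<noteq> v" "(u, v) \<notin> parcs G"
  shows "\<exists>S. S \<noteq> {} \<and> S \<subset> pverts G \<and> (\<forall>s \<in> S. \<forall>t \<in> pverts G - S. (s, t) \<in> parcs G)"
proof -
  have "separation G (pverts G - {u, v}) {u} {v}"
    using uv unfolding separation_def by auto
  then have "\<exists>A B. separation G (pverts G - {u, v}) A B" by blast
  from ex_has_least_nat[of "\<lambda>S. \<exists>A B. separation G S A B", OF this, of card]
  obtain S A B where sep: "separation G S A B"
    and min: "\<And>S' A' B'. separation G S' A' B' \<Longrightarrow> card S \<le> card S'" by blast
  show ?thesis
  proof (intro exI[of _ S] conjI ballI)
    show "S \<noteq> {}" by (rule connected_separation_nonempty[OF con sep])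
    show "S \<subset> pverts G" using sep unfolding separation_def by blast
    show "(s, t) \<in> parcs G" if "s \<in> S" "t \<in> pverts G - S" for s t
      using P4 sep min that by (rule minimal_separator_joined)
  qed
qed

section \<open>One cop on a small cograph\<close>

lemma cops_move_singleton: "cops_move G [c] C' \<longleftrightarrow> (\<exists>c'. C' = [c'] \<and> legal_move G c c')"
  unfolding cops_move_def by (auto simp: list_all2_Cons1)

lemma can_capture_singleton: "can_capture G [c] r \<longleftrightarrow> legal_move G c r"
  unfolding can_capture_def cops_move_singleton captured_def by auto

text \<open>The cop at \<open>c\<close> decides the game in its first turn: it captures when it can
  and otherwise stays, which already confines the robber.\<close>

lemma can_confine_oneI:
  assumes c: "c \<in> pverts G"
    and dom: "\<And>r x. r \<in> pverts G \<Longrightarrow> \<not> legal_move G c r \<Longrightarrow> (r, x) \<in> parcs G \<Longrightarrow> (c, x) \<in> parcs G"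
  shows "can_confine G 1"
proof -
  have "cops_win G [c] r" if r: "r \<in> pverts G" for r
  proof (cases "legal_move G c r")
    case True
    then show ?thesis
      by (intro cops_win.capture[of G _ "[r]"]) (auto simp: cops_move_singleton captured_def)
  next
    case False
    have "confined G [c] r"
      unfolding confined_def can_capture_singleton
      using False dom[OF r False] by (auto simp: legal_move_def)
    then show ?thesis
      by (intro cops_win.confine[of G _ "[c]"]) (auto simp: cops_move_singleton legal_move_def)
  qed
  then show ?thesis
    unfolding can_confine_def using c by (intro exI[of _ "[c]"]) auto
qed

text \<open>
  A vertex \<open>c\<close> fails only if it is isolated in \<open>G[C]\<close> while the other two vertices of \<open>C\<close> are
  adjacent; then either of these two works.
\<close>

lemma (in pair_graph) small_join_side:
  assumes C: "C \<noteq> {}" "C \<subseteq> pverts G" "card C \<le> 3"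
    and join: "\<And>s t. s \<in> C \<Longrightarrow> t \<in> pverts G - C \<Longrightarrow> (s, t) \<in> parcs G"
  shows "can_confine G 1"
proof (rule ccontr)
  assume neg: "\<not> can_confine G 1"
  have fin: "finite C" using C(2) pair_finite_verts by (rule finite_subset)
  have fail: "\<exists>r \<in> C. \<exists>x \<in> C. r \<noteq> c \<and> x \<noteq> c \<and> (c, r) \<notin> parcs G \<and> (c, x) \<notin> parcs G \<and>
    (r, x) \<in> parcs G" if c: "c \<in> C" for c
  proof -
    obtain r x where rx: "r \<in> pverts G" "\<not> legal_move G c r" "(r, x) \<in> parcs G" "(c, x) \<notin> parcs G"
      using can_confine_oneI[of c G] neg c C(2) by blast
    \<comment> \<open>The join makes \<open>c\<close> adjacent to everything outside
      \<open>C\<close>, so its non-neighbours \<open>r\<close> and \<open>x\<close> lie in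
      \<open>C\<close>.\<close>
    have "r \<in> C" "x \<in> C" using rx join[OF c] in_arcsD2 by (auto simp: legal_move_def)
    moreover have "x \<noteq> c" using rx parcs_sym by (auto simp: legal_move_def)
    ultimately show ?thesis using rx by (auto simp: legal_move_def)
  qed
  obtain c where c: "c \<in> C" using C(1) by blast
  from fail[OF c] obtain r x where rx: "r \<in> C" "x \<in> C" "r \<noteq> c" "x \<noteq> c" "(r, x) \<in> parcs G" by blast
  then have "r \<noteq> x" using parcs_irrefl by blast
  then have "card {c, r, x} = 3" using rx by auto
  then have "C = {c, r, x}"
    using card_seteq[OF fin, of "{c, r, x}"] c rx C(3) by auto
  \<comment> \<open>As \<open>r\<close> is adjacent to \<open>x\<close>, its only possible
    non-neighbour in \<open>C\<close> besides itself is \<open>c\<close>, so the arc promised by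
    \<open>fail\<close> would be a loop.\<close>
  then show False using fail[OF rx(1)] rx(5) parcs_irrefl by blast
qed

lemma small_cograph_can_confine_one:
  assumes "connected_cograph G" "card (pverts G) < 8"
  shows "can_confine G 1"
proof -
  interpret pair_graph G using assms(1) by (simp add: connected_cograph_def cograph_def)
  have P4: "\<nexists>a b c d. induced_P4 G a b c d" and con: "Digraph_Component.connected (with_proj G)"
    using assms(1) by (auto simp: connected_cograph_def cograph_def)
  show ?thesis
  proof (cases "\<exists>u v. u \<in> pverts G \<and> v \<in> pverts G \<and> u \<noteq> v \<and> (u, v) \<notin> parcs G")
    case False
    obtain c where "c \<in> pverts G" using con connected_iff by blast
    then show ?thesis using False by (intro can_confine_oneI) (auto simp: legal_move_def)
  next
    case True
    then obtain u v where uv: "u \<in> pverts G" "v \<in> pverts G" "u \<noteq> v" "(u, v) \<notin> parcs G"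
      by blast
    obtain S where S: "S \<noteq> {}" "S \<subset> pverts G"
      and join: "\<And>s t. s \<in> S \<Longrightarrow> t \<in> pverts G - S \<Longrightarrow> (s, t) \<in> parcs G"
      using cograph_join[OF P4 con uv] by blast
    have "card S + card (pverts G - S) = card (pverts G)"
      using S(2) pair_finite_verts
      by (metis card_Diff_subset card_mono finite_subset le_add_diff_inverse psubset_imp_subset)
    \<comment> \<open>The bound 8 enters here: two sides with at least four vertices each would need
      eight.\<close>
    with assms(2) consider "card S \<le> 3" | "card (pverts G - S) \<le> 3" by linarith
    then show ?thesis
    proof cases
      case 1
      then show ?thesis using S join by (intro small_join_side[of S]) auto
    next
      case 2
      then show ?thesis using S join parcs_sym by (intro small_join_side[of "pverts G - S"]) auto
    qed
  qed
qed

section \<open>Cographs that need two cops\<close>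

text \<open>The robber's invariant, with the cop to move, is to be outside the closed neighbourhood
  of the cop: \<open>free\<close> provides a start, \<open>escape\<close> restores it after a cop
  move, and \<open>not_confined\<close> rules out confinement.\<close>

lemma not_can_confine_one:
  assumes free: "\<And>c. c \<in> pverts G \<Longrightarrow> \<exists>r \<in> pverts G. \<not> legal_move G c r"
    and not_confined: "\<And>c r. \<lbrakk>c \<in> pverts G; r \<in> pverts G; \<not> legal_move G c r\<rbrakk> \<Longrightarrow>
      \<exists>r' \<in> pverts G. legal_move G r r' \<and> r' \<noteq> r \<and> \<not> legal_move G c r'"
    and escape: "\<And>c r c'. \<lbrakk>c \<in> pverts G; r \<in> pverts G; c' \<in> pverts G; \<not> legal_move G c r;
      legal_move G c c'\<rbrakk> \<Longrightarrow> \<exists>r' \<in> pverts G. legal_move G r r' \<and> \<not> legal_move G c' r'"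
    and wf: "pair_wf_digraph G"
  shows "\<not> can_confine G 1"
proof
  interpret pair_wf_digraph G by (rule wf)
  have legal: "c' \<in> pverts G" if "c \<in> pverts G" "legal_move G c c'" for c c'
    using that in_arcsD2 by (auto simp: legal_move_def)
  \<comment> \<open>The contrapositive of the invariant, by induction on the cop's finite winning
    strategy.\<close>
  have win: "legal_move G c r"
    if "cops_win G C r" "C = [c]" "c \<in> pverts G" "r \<in> pverts G" for C c r
    using that
  proof (induction arbitrary: c rule: cops_win.induct)
    case (already_captured C r)
    then show ?case by (auto simp: captured_def legal_move_def)
  next
    case (capture C C' r)
    then show ?case by (auto simp: cops_move_singleton captured_def)
  next
    case (confine C C' r)
    then obtain c' where c': "C' = [c']" "legal_move G c c'" by (auto simp: cops_move_singleton)
    have "c' \<in> pverts G" using legal c' confine.prems by blast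
    moreover have "confined G [c'] r" using confine.hyps c' by simp
    ultimately show ?case
      using not_confined[of c' r] confine.prems unfolding confined_def can_capture_singleton by blast
  next
    case (continue C C' r)
    then obtain c' where c': "C' = [c']" "legal_move G c c'" by (auto simp: cops_move_singleton)
    have "c' \<in> pverts G" using legal c' continue.prems by blast
    then show ?case using escape[of c r c'] continue c' by blast
  qed
  assume "can_confine G 1"
  then obtain C where "length C = 1" "set C \<subseteq> pverts G" "\<forall>r \<in> pverts G. cops_win G C r"
    unfolding can_confine_def by blast
  then obtain c where "C = [c]" "c \<in> pverts G" by (cases C) auto
  then show False using win free \<open>\<forall>r \<in> pverts G. cops_win G C r\<close> by blast
qed

text \<open>The four cliques are the residue classes modulo \<open>4\<close>; opposite ones differ by \<open>2\<close>.\<close>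

definition residue_graph :: "nat \<Rightarrow> nat pair_pre_digraph" where
  "residue_graph n = \<lparr>pverts = {..<n},
     parcs = {(u, v). u < n \<and> v < n \<and> u \<noteq> v \<and> (u + 2) mod 4 \<noteq> v mod 4}\<rparr>"

lemma pverts_residue_graph [simp]: "pverts (residue_graph n) = {..<n}"
  by (simp add: residue_graph_def)

lemma parcs_residue_graph [simp]:
  "(u, v) \<in> parcs (residue_graph n) \<longleftrightarrow>
     u < n \<and> v < n \<and> u \<noteq> v \<and> (u + 2) mod 4 \<noteq> v mod 4"
  by (simp add: residue_graph_def)

text \<open>Adding 2 twice is adding 4; this yields the symmetry of the arcs.\<close>

lemma add_2_mod_4_swap: "(u + 2) mod 4 = v mod 4 \<longleftrightarrow> (v + 2) mod 4 = u mod 4" for u v :: nat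
proof -
  have "(y + 2) mod 4 = x mod 4" if "(x + 2) mod 4 = y mod 4" for x y :: nat
    using mod_add_cong[OF that refl[of "2 mod 4"]] by (simp add: add.assoc)
  then show ?thesis by blast
qed

lemma add_2_mod_4_neq: "(u + 2) mod 4 \<noteq> u mod 4" for u :: nat
  by (simp add: mod_Suc)

text \<open>Staying needs no case of its own, as no class is opposite to itself.\<close>

lemma legal_move_residue_graph:
  "u < n \<Longrightarrow> v < n \<Longrightarrow> legal_move (residue_graph n) u v \<longleftrightarrow> (u + 2) mod 4 \<noteq> v mod 4"
  unfolding legal_move_def using add_2_mod_4_neq[of u] by auto

lemma pair_graph_residue_graph: "pair_graph (residue_graph n)"
proof -
  have "parcs (residue_graph n) \<subseteq> {..<n} \<times> {..<n}" by auto
  then have "finite (parcs (residue_graph n))" by (rule finite_subset) simp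
  then show ?thesis
    by unfold_locales (auto simp: symmetric_def sym_def dest: add_2_mod_4_swap[simplified, THEN iffD1])
qed

lemma connected_cograph_residue_graph:
  assumes "n \<ge> 4"
  shows "connected_cograph (residue_graph n)"
proof -
  interpret pair_graph "residue_graph n" by (rule pair_graph_residue_graph)
  have "reachable (with_proj (residue_graph n)) u v" if uv: "u < n" "v < n" for u v
  proof (cases "(u, v) \<in> parcs (residue_graph n) \<or> u = v")
    case True
    then show ?thesis using uv by auto
  next
    case False
    \<comment> \<open>Here \<open>u\<close> and \<open>v\<close> are in equal or opposite classes,
      and the next class is adjacent to both; its representative below 4 is a vertex.\<close>
    define w where "w = (u + 1) mod 4"
    have "w < n" using assms unfolding w_def
      by (metis mod_less_divisor less_le_trans zero_less_numeral)
    moreover have "(u + 2) mod 4 = v mod 4" using False uv by auto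
    moreover have "u mod 4 \<noteq> w mod 4" "(u + 2) mod 4 \<noteq> w mod 4"
      "w mod 4 \<noteq> (u + 2) mod 4" "(w + 2) mod 4 \<noteq> (u + 2) mod 4"
      unfolding w_def by (auto simp: mod_Suc split: if_splits)
    ultimately have "(u, w) \<in> parcs (residue_graph n)" "(w, v) \<in> parcs (residue_graph n)"
      using uv by auto
    then show ?thesis using reachable_trans[OF reachable_adjI reachable_adjI] by blast
  qed
  then have "Digraph_Component.connected (with_proj (residue_graph n))"
    unfolding connected_iff using assms by (auto simp: lessThan_empty_iff)
  \<comment> \<open>In an induced path \<open>a, b, c, d\<close>, both \<open>c\<close> and
    \<open>d\<close> would be opposite \<open>a\<close>, and \<open>d\<close> opposite
    \<open>b\<close>, so \<open>c\<close> would be opposite \<open>b\<close>, against their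
    edge.\<close>
  moreover have "\<not> induced_P4 (residue_graph n) a b c d" for a b c d
    unfolding induced_P4_def by auto
  ultimately show ?thesis
    using pair_graph_residue_graph by (simp add: connected_cograph_def cograph_def)
qed

lemma not_can_confine_one_residue_graph:
  assumes "n \<ge> 8"
  shows "\<not> can_confine (residue_graph n) 1"
proof (rule not_can_confine_one)
  interpret pair_graph "residue_graph n" by (rule pair_graph_residue_graph)
  show "pair_wf_digraph (residue_graph n)" ..
  \<comment> \<open>Since \<open>n \<ge> 8\<close>, each class contains two vertices,
    \<open>k mod 4\<close> and \<open>k mod 4 + 4\<close>.\<close>
  have mod_less: "k mod 4 < n" "k mod 4 + 4 < n" for k using assms mod_less_divisor[of 4 k] by linarith+
  show "\<exists>r \<in> pverts (residue_graph n). \<not> legal_move (residue_graph n) c r"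
    if "c \<in> pverts (residue_graph n)" for c
    using that mod_less by (intro bexI[of _ "(c + 2) mod 4"]) (auto simp: legal_move_residue_graph)
  show "\<exists>r' \<in> pverts (residue_graph n). legal_move (residue_graph n) r r' \<and> r' \<noteq> r \<and>
      \<not> legal_move (residue_graph n) c r'"
    if "c \<in> pverts (residue_graph n)" "r \<in> pverts (residue_graph n)"
      "\<not> legal_move (residue_graph n) c r" for c r
  proof -
    \<comment> \<open>A second vertex in the clique of \<open>r\<close>, equally out of the cop's
      reach.\<close>
    define r' where "r' = (if r mod 4 = r then r mod 4 + 4 else r mod 4)"
    have "r' < n" "r' \<noteq> r" "r' mod 4 = r mod 4" using mod_less[of r] by (auto simp: r'_def)
    then show ?thesis using that add_2_mod_4_neq[of r]
      by (intro bexI[of _ r']) (auto simp: legal_move_residue_graph)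
  qed
  show "\<exists>r' \<in> pverts (residue_graph n). legal_move (residue_graph n) r r' \<and>
      \<not> legal_move (residue_graph n) c' r'"
    if "c \<in> pverts (residue_graph n)" "r \<in> pverts (residue_graph n)" "c' \<in> pverts (residue_graph n)"
      "\<not> legal_move (residue_graph n) c r" "legal_move (residue_graph n) c c'" for c r c'
  proof -
    \<comment> \<open>The robber heads for the clique opposite \<open>c'\<close>. Its own clique is
      opposite \<open>c\<close>; since \<open>c\<close> and \<open>c'\<close> are not opposite,
      neither are these two cliques, and the move is legal.\<close>
    have "(c + 2) mod 4 = r mod 4" "(c + 2) mod 4 \<noteq> c' mod 4"
      using that by (auto simp: legal_move_residue_graph)
    moreover have "(r + 2) mod 4 = c mod 4"
      using calculation(1) add_2_mod_4_swap by metis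
    ultimately have "(r + 2) mod 4 \<noteq> (c' + 2) mod 4"
      using add_2_mod_4_swap[of c' c] by metis
    then show ?thesis using that mod_less
      by (intro bexI[of _ "(c' + 2) mod 4"]) (auto simp: legal_move_residue_graph)
  qed
qed

lemma can_confine_two_residue_graph:
  assumes "n \<ge> 8"
  shows "can_confine (residue_graph n) 2"
proof -
  have "cops_win (residue_graph n) [0, 1] r" if r: "r < n" for r
  proof (cases "legal_move (residue_graph n) 0 r")
    case True
    then show ?thesis
      by (intro cops_win.capture[of _ _ "[r, 1]"])
        (auto simp: cops_move_def captured_def legal_move_def)
  next
    case False
    \<comment> \<open>Only the clique of residue 2 is out of reach of the cop at 0; the cop at 1
      reaches it.\<close>
    then have "(0 + 2) mod 4 = r mod 4"
      using assms r legal_move_residue_graph[of 0 n r] by simp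
    then have "legal_move (residue_graph n) 1 r"
      using assms r legal_move_residue_graph[of 1 n r] by simp
    then show ?thesis
      by (intro cops_win.capture[of _ _ "[0, r]"])
        (auto simp: cops_move_def captured_def legal_move_def)
  qed
  then show ?thesis
    unfolding can_confine_def using assms by (intro exI[of _ "[0, 1]"]) auto
qed

theorem theorem3p5:
  shows "(\<forall>G :: 'a pair_pre_digraph.
            connected_cograph G \<and> card (pverts G) < 8 \<longrightarrow> ccn G = 1) \<and>
         (\<forall>n :: nat. n \<ge> 8 \<longrightarrow>
            (\<exists>G :: nat pair_pre_digraph.
               connected_cograph G \<and> card (pverts G) = n \<and> ccn G = 2))"
proof (intro conjI allI impI)
  fix G :: "'a pair_pre_digraph"
  assume "connected_cograph G \<and> card (pverts G) < 8"
  \<comment> \<open>The lower bound 1 is built into \<open>ccn\<close>.\<close>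
  then show "ccn G = 1"
    unfolding ccn_def by (intro Least_equality) (auto intro: small_cograph_can_confine_one[simplified])
next
  fix n :: nat
  assume n: "n \<ge> 8"
  have "ccn (residue_graph n) = 2"
    unfolding ccn_def
  proof (rule Least_equality)
    show "2 \<ge> (1::nat) \<and> can_confine (residue_graph n) 2"
      using can_confine_two_residue_graph[OF n] by simp
    fix k
    assume "k \<ge> 1 \<and> can_confine (residue_graph n) k"
    then show "2 \<le> k"
      using not_can_confine_one_residue_graph[OF n] by (cases "k = 1") auto
  qed
  then show "\<exists>G :: nat pair_pre_digraph.
      connected_cograph G \<and> card (pverts G) = n \<and> ccn G = 2"
    using connected_cograph_residue_graph n by (intro exI[of _ "residue_graph n"]) auto
qed

end
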